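(* Let $k_1,\dots,k_n$ be positive integers with $\gcd(k_1,\dots,k_n)=1$, and let \[ \Omega_C=\left\{(z_1,\dots,z_n)\in\mathbb{C}^n : |z_1|^{k_1}<|z_2|^{k_2}<\cdots<|z_n|^{k_n}<1\right\}. \] Set $K_{j,i}:=\dfrac{k_1k_2\cdots k_i}{k_j}$ for $1\le j\le i$, $1\le i\le n$, and for each $1\le i\le n$ let $m_i:=\gcd(K_{1,i},\dots,K_{i,i})$. Let $1\le p<\infty$. Then \[ S_p(\Omega_C)=\left\{(\alpha_1,\dots,\alpha_n)\in\mathbb{Z}^n : \left(\sum_{j=1}^i K_{j,i}\alpha_j\right)p>-2\sum_{j=1}^i K_{j,i}\ \text{for all }1\le i\le n\right\}. \] The set of Threshold exponents of $\Omega_C$ is \[ \mathrm{Threshold}(\Omega_C)=\left\{\frac{L_i}{\ell_i} : 1\le i\le n,\ \ell_i\in\mathbb{Z},\ 1\le \ell_i\le L_i-1\right\}, \] where \[ L_i:=\frac{2\sum_{j=1}^i K_{j,i}}{m_i}. \]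
   Context: For a domain $\Omega\subset\mathbb{C}^n$ and $1\le p<\infty$, the $p$-Bergman space $A^p(\Omega)$ is the space of holomorphic functions $f$ on $\Omega$ with $\int_\Omega |f|^p\,dV<\infty$, where $dV$ is Lebesgue measure. For $\alpha=(\alpha_1,\dots,\alpha_n)\in\mathbb{Z}^n$, $e_\alpha(z):=z_1^{\alpha_1}\cdots z_n^{\alpha_n}$, with the convention that negative exponents are interpreted as Laurent monomials whenever they are locally integrable. For a Reinhardt domain $\Omega$ (a domain invariant under $(z_1,\dots,z_n)\mapsto(e^{i\tau_1}z_1,\dots,e^{i\tau_n}z_n)$ for all real $\tau_1,\dots,\tau_n$), the $p$-allowable index set is $S_p(\Omega):=\{\alpha\in\mathbb{Z}^n : e_\alpha\in A^p(\Omega)\}$. A number $p\in[1,\infty)$ is called a Threshold exponent for $\Omega$ if for every $\varepsilon>0$ there exists $q\in(p-\varepsilon,p+\varepsilon)$ such that $S_q(\Omega)\neq S_p(\Omega)$. $\mathrm{Threshold}(\Omega)$ denotes the set of Threshold exponents of $\Omega$. *)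

theory Defs
  imports "HOL-Analysis.Analysis"
begin

text \<open>
  Points of complex n-space are vectors of type \<open>complex ^ 'n\<close>, with the coordinates ordered by
  the linear order of the finite index type \<open>'n\<close>; the initial segment 1, ..., i is \<open>{..i}\<close>.
\<close>

text \<open>
  Holomorphy in several variables: complex Frechet differentiability, i.e. the real derivative
  exists and is complex linear.
\<close>

definition holomorphic_vec_on :: "(complex ^ 'n \<Rightarrow> complex) \<Rightarrow> (complex ^ 'n::finite) set \<Rightarrow> bool"
  where "holomorphic_vec_on f \<Omega> \<longleftrightarrow>
    (\<forall>z\<in>\<Omega>. \<exists>c::complex ^ 'n. (f has_derivative (\<lambda>h. \<Sum>j\<in>UNIV. c $ j * h $ j)) (at z within \<Omega>))"

definition bergman_space :: "real \<Rightarrow> (complex ^ 'n::finite) set \<Rightarrow> (complex ^ 'n \<Rightarrow> complex) set"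
  where "bergman_space p \<Omega> =
    {f. holomorphic_vec_on f \<Omega> \<and> set_integrable lborel \<Omega> (\<lambda>z. norm (f z) powr p)}"

definition locally_integrable_on :: "(complex ^ 'n \<Rightarrow> complex) \<Rightarrow> (complex ^ 'n::finite) set \<Rightarrow> bool"
  where "locally_integrable_on f \<Omega> \<longleftrightarrow>
    (\<forall>C. compact C \<and> C \<subseteq> \<Omega> \<longrightarrow> set_integrable lborel C f)"

definition laurent_monomial :: "int ^ 'n \<Rightarrow> complex ^ 'n::finite \<Rightarrow> complex"
  where "laurent_monomial \<alpha> z = (\<Prod>j\<in>UNIV. (z $ j) powi (\<alpha> $ j))"

definition polar_locus :: "int ^ 'n \<Rightarrow> (complex ^ 'n::finite) set"
  where "polar_locus \<alpha> = {z. \<exists>j. \<alpha> $ j < 0 \<and> z $ j = 0}"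

text \<open>
  A monomial with negative exponents is admitted as a Laurent monomial on \<open>\<Omega>\<close> as soon as it is
  locally integrable there, even if \<open>\<Omega>\<close> meets its poles. It is then defined, and required to be
  holomorphic, only off the polar locus, which is a Lebesgue null set. Hence on the unit disc
  \<open>1 / z\<close> is allowable for \<open>p < 2\<close>. If \<open>\<Omega>\<close> does not meet the polar locus, then the monomial is
  continuous on \<open>\<Omega>\<close> and the condition is just membership in the Bergman space of \<open>\<Omega>\<close>.
\<close>

definition allowable_indices :: "real \<Rightarrow> (complex ^ 'n::finite) set \<Rightarrow> (int ^ 'n) set"
  where "allowable_indices p \<Omega> =
    {\<alpha>. locally_integrable_on (laurent_monomial \<alpha>) \<Omega> \<and>
         laurent_monomial \<alpha> \<in> bergman_space p (\<Omega> - polar_locus \<alpha>)}"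

text \<open>
  The nearby exponents \<open>q\<close> are confined to \<open>q \<ge> 1\<close>, where the Bergman spaces are considered; this
  matters only at \<open>p = 1\<close>.
\<close>

definition Threshold :: "(complex ^ 'n::finite) set \<Rightarrow> real set"
  where "Threshold \<Omega> =
    {p. 1 \<le> p \<and>
        (\<forall>\<epsilon>>0. \<exists>q\<in>{p - \<epsilon> <..< p + \<epsilon>}. 1 \<le> q \<and> allowable_indices q \<Omega> \<noteq> allowable_indices p \<Omega>)}"

definition Omega_C :: "('n::{finite,linorder} \<Rightarrow> nat) \<Rightarrow> (complex ^ 'n::{finite,linorder}) set"
  where "Omega_C k =
    {z. strict_mono (\<lambda>j. norm (z $ j) ^ k j) \<and> (\<forall>j. norm (z $ j) ^ k j < 1)}"

text \<open>The division is exact, since only \<open>j \<le> i\<close> is relevant.\<close>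

definition K_num :: "('n::{finite,linorder} \<Rightarrow> nat) \<Rightarrow> 'n \<Rightarrow> 'n \<Rightarrow> nat"
  where "K_num k j i = (\<Prod>l\<in>{..i}. k l) div k j"

definition m_gcd :: "('n::{finite,linorder} \<Rightarrow> nat) \<Rightarrow> 'n \<Rightarrow> nat"
  where "m_gcd k i = Gcd ((\<lambda>j. K_num k j i) ` {..i})"

definition L_num :: "('n::{finite,linorder} \<Rightarrow> nat) \<Rightarrow> 'n \<Rightarrow> real"
  where "L_num k i = 2 * (\<Sum>j\<in>{..i}. real (K_num k j i)) / real (m_gcd k i)"

end

theory Submission
  imports Defs
begin

text \<open>
  Off the coordinate hyperplanes, \<open>Omega_C k\<close> is covered by the polyannular shells on which
  \<open>norm (z $ j) ^ k j\<close> lies between consecutive powers \<open>2 ^ - (m j + 1)\<close> and \<open>2 ^ - m j\<close>, with \<open>m\<close>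
  decreasing in \<open>j\<close>. A coordinatewise dilation maps the shell of \<open>m = 0\<close> to that of \<open>m\<close>, so the
  integral of \<open>norm (laurent_monomial \<alpha> z) powr p\<close> over the latter is \<open>2 ^ - (\<Sum>j. m j * b j)\<close> times
  the one over the former, where \<open>b j = (\<alpha> $ j * p + 2) / k j\<close>. Writing \<open>m j\<close> as a tail sum
  of free nonnegative integers \<open>d i\<close> turns the total into a product of geometric series with ratios
  \<open>2 ^ - (\<Sum>j\<le>i. b j)\<close>, which gives the description of the allowable indices.

  The \<open>i\<close>-th condition on \<open>\<alpha>\<close> reads \<open>p * a > - L_num k i\<close> with an arbitrary integer \<open>a\<close>, so it can change
  only at the quotients \<open>L_num k i / l\<close>; every such quotient above 1 is attained because \<open>\<alpha>\<close> can be
  chosen with \<open>a = - l\<close> and all other conditions slack.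
\<close>

section \<open>Coordinatewise dilations and the change of variables\<close>

definition dilation :: "('n \<Rightarrow> real) \<Rightarrow> complex ^ 'n \<Rightarrow> complex ^ 'n::finite"
  where "dilation c z = (\<chi> j. c j *\<^sub>R z $ j)"

lemma dilation_nth [simp]: "dilation c z $ j = c j *\<^sub>R z $ j"
  by (simp add: dilation_def)

text \<open>Each complex coordinate carries two real basis vectors, both scaled by
  \<open>c j\<close>, so the Jacobian determinant is the product of the squares.\<close>

lemma nn_integral_dilation:
  fixes f :: "complex ^ 'n::finite \<Rightarrow> ennreal"
  assumes c: "\<And>j. c j > 0" and [measurable]: "f \<in> borel_measurable borel"
  shows "(\<integral>\<^sup>+z. f z \<partial>lborel) = ennreal (\<Prod>j\<in>UNIV. (c j)\<^sup>2) * (\<integral>\<^sup>+z. f (dilation c z) \<partial>lborel)"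
proof -
  \<comment> \<open>The eigenvalue of the dilation at the real basis vector \<open>b\<close>, the
    form in which \<open>lborel_affine_euclidean\<close> takes a diagonal map.\<close>
  define c' :: "complex ^ 'n \<Rightarrow> real" where "c' b = dilation c b \<bullet> b" for b
  have c'_axis: "c' (axis j u) = c j" if "u \<in> Basis" for j u
  proof -
    have "dilation c (axis j u) = axis j (c j *\<^sub>R u)"
      by (simp add: vec_eq_iff axis_def)
    then show ?thesis
      using that by (simp add: c'_def inner_axis_axis inner_Basis)
  qed
  have T: "0 + (\<Sum>b\<in>Basis. (c' b * (x \<bullet> b)) *\<^sub>R b) = dilation c x" for x
  proof (rule euclidean_eqI)
    fix b :: "complex ^ 'n" assume b: "b \<in> Basis"
    then obtain j u where ju: "b = axis j u" "u \<in> Basis"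
      by (auto simp: Basis_vec_def)
    show "(0 + (\<Sum>b\<in>Basis. (c' b * (x \<bullet> b)) *\<^sub>R b)) \<bullet> b = dilation c x \<bullet> b"
      using b ju(2) unfolding add_0 inner_sum_left_Basis[OF b] by (simp add: ju(1) inner_axis c'_axis)
  qed
  have "c' b \<noteq> 0" if "b \<in> Basis" for b
    using that c by (auto simp: Basis_vec_def c'_axis less_imp_neq[symmetric] simp del: Basis_complex_def)
  then have lb: "lborel = density (distr lborel borel (dilation c)) (\<lambda>_. ennreal (\<Prod>b\<in>Basis. \<bar>c' b\<bar>))"
    using lborel_affine_euclidean[of c' 0] unfolding T by blast
  have bij: "bij_betw (\<lambda>(j, u). axis j u) (UNIV \<times> Basis) (Basis :: (complex ^ 'n) set)"
    by (auto simp: bij_betw_def inj_on_def axis_eq_axis Basis_vec_def image_iff nonzero_Basis simp del: Basis_complex_def)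
  have "(\<Prod>b\<in>Basis. \<bar>c' b\<bar>) = (\<Prod>(j, u)\<in>UNIV \<times> Basis. \<bar>c' (axis j u :: complex ^ 'n)\<bar>)"
    by (subst prod.reindex_bij_betw[OF bij, symmetric]) (simp add: case_prod_unfold)
  also have "\<dots> = (\<Prod>(j, u)\<in>UNIV \<times> (Basis :: complex set). c j)"
    using c by (intro prod.cong refl) (auto simp: c'_axis less_imp_le simp del: Basis_complex_def)
  also have "\<dots> = (\<Prod>j\<in>UNIV. (c j)\<^sup>2)"
    by (subst prod.cartesian_product[symmetric]) simp
  finally have P: "(\<Prod>b\<in>Basis. \<bar>c' b\<bar>) = (\<Prod>j\<in>UNIV. (c j)\<^sup>2)" .
  have [measurable]: "dilation c \<in> borel_measurable borel"
    by (intro borel_measurable_continuous_onI) (auto simp: dilation_def intro!: continuous_intros)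
  have "(\<integral>\<^sup>+z. f z \<partial>lborel) =
      (\<integral>\<^sup>+z. f z \<partial>density (distr lborel borel (dilation c)) (\<lambda>_. ennreal (\<Prod>j\<in>UNIV. (c j)\<^sup>2)))"
    by (subst lb) (simp only: P)
  also have "\<dots> = ennreal (\<Prod>j\<in>UNIV. (c j)\<^sup>2) * (\<integral>\<^sup>+z. f z \<partial>distr lborel borel (dilation c))"
    by (subst nn_integral_density) (auto intro!: nn_integral_cmult)
  finally show ?thesis
    by (simp add: nn_integral_distr)
qed

text \<open>The sum over all functions \<open>d\<close> factors into one convergent geometric series
  per index.\<close>

lemma nn_integral_prod_geometric_finite:
  fixes r :: "'n::finite \<Rightarrow> real"
  assumes r: "\<And>i. 0 \<le> r i" "\<And>i. r i < 1"
  shows "(\<integral>\<^sup>+d. ennreal (\<Prod>i\<in>UNIV. r i ^ d i) \<partial>count_space (UNIV :: ('n \<Rightarrow> nat) set)) < \<infinity>"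
proof -
  have "Infinite_Set_Sum.abs_summable_on (\<lambda>g. \<Prod>i\<in>UNIV. (\<lambda>n. r i ^ n) (g i)) (PiE (UNIV :: 'n set) (\<lambda>_. UNIV :: nat set))"
    using r by (intro abs_summable_on_prod_PiE) (auto simp: abs_summable_on_nat_iff')
  then have "Infinite_Set_Sum.abs_summable_on (\<lambda>g. \<Prod>i\<in>UNIV. r i ^ g i) (UNIV :: ('n \<Rightarrow> nat) set)"
    by (simp add: PiE_UNIV_domain)
  then show ?thesis
    using r by (subst nn_integral_conv_infsetsum) (auto intro: prod_nonneg)
qed

section \<open>Dyadic shells and the scaling of their mass\<close>

text \<open>The bounds are on the quantities that \<open>Omega_C\<close> compares, so a condition on
  \<open>m\<close> alone can place a shell inside \<open>Omega_C\<close>. Half-open intervals make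
  shells with different \<open>m\<close> disjoint.\<close>

definition shell :: "('n \<Rightarrow> nat) \<Rightarrow> ('n \<Rightarrow> nat) \<Rightarrow> (complex ^ 'n::finite) set"
  where "shell k m = {z. \<forall>j. (1/2) ^ Suc (m j) \<le> norm (z $ j) ^ k j \<and> norm (z $ j) ^ k j < (1/2) ^ m j}"

lemma borel_measurable_vec_nth [measurable]: "(\<lambda>z. z $ j) \<in> borel_measurable (borel :: (complex ^ 'n::finite) measure)"
  by (intro borel_measurable_continuous_onI continuous_intros)

lemma shell_sets [measurable]: "shell k m \<in> sets borel"
  unfolding shell_def by measurable

lemma laurent_monomial_measurable [measurable]: "laurent_monomial \<alpha> \<in> borel_measurable borel"
  unfolding laurent_monomial_def[abs_def] power_int_def by measurable

lemma laurent_monomial_dilation: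
  "laurent_monomial \<alpha> (dilation c z) = of_real (\<Prod>j\<in>UNIV. c j powi (\<alpha> $ j)) * laurent_monomial \<alpha> z"
  by (simp add: laurent_monomial_def power_int_mult_distrib scaleR_conv_of_real prod.distrib)

definition shell_mass :: "real \<Rightarrow> int ^ 'n \<Rightarrow> ('n \<Rightarrow> nat) \<Rightarrow> ('n \<Rightarrow> nat) \<Rightarrow> ennreal" where
  "shell_mass p \<alpha> k m = (\<integral>\<^sup>+z\<in>shell k m. ennreal (norm (laurent_monomial \<alpha> z) powr p) \<partial>(lborel :: (complex ^ 'n::finite) measure))"

text \<open>In the power of the radius, the monomial contributes \<open>\<alpha> $ j * p\<close> and
  the planar area 2. Division by \<open>k j\<close> converts this to a power of
  \<open>norm (z $ j) ^ k j\<close>.\<close>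

definition shell_exponent :: "real \<Rightarrow> int ^ 'n \<Rightarrow> ('n \<Rightarrow> nat) \<Rightarrow> 'n \<Rightarrow> real" where
  "shell_exponent p \<alpha> k j = (real_of_int (\<alpha> $ j) * p + 2) / real (k j)"

lemma shell_mass_scaling:
  fixes \<alpha> :: "int ^ 'n::finite"
  assumes k: "\<And>j. 0 < k j"
  shows "shell_mass p \<alpha> k m =
    ennreal (\<Prod>j\<in>UNIV. (1/2) powr (real (m j) * shell_exponent p \<alpha> k j)) * shell_mass p \<alpha> k (\<lambda>_. 0)"
proof -
  define c where "c j = (1/2::real) powr (real (m j) / real (k j))" for j
  have c: "c j > 0" for j by (simp add: c_def)
  have ck: "c j ^ k j = (1/2) ^ m j" for j
    using k[of j] by (simp add: c_def powr_realpow[symmetric] powr_powr del: powr_realpow)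
  have shell: "dilation c z \<in> shell k m \<longleftrightarrow> z \<in> shell k (\<lambda>_. 0)" for z
    using c by (auto simp: shell_def power_mult_distrib ck abs_of_pos)
  \<comment> \<open>Jacobian and monomial factor merge into one power of \<open>c j\<close>, which
    is itself 1/2 to the power \<open>m j / k j\<close>.\<close>
  have sc: "(c j)\<^sup>2 * (c j powi (\<alpha> $ j)) powr p = (1/2) powr (real (m j) * shell_exponent p \<alpha> k j)" for j
  proof -
    have "c j powi (\<alpha> $ j) = c j powr (\<alpha> $ j)"
      using c[of j] by (simp add: powr_real_of_int')
    moreover have "(c j)\<^sup>2 = c j powr 2" using c[of j] by simp
    ultimately have "(c j)\<^sup>2 * (c j powi (\<alpha> $ j)) powr p = c j powr (2 + \<alpha> $ j * p)"
      by (simp add: powr_powr powr_add)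
    then show ?thesis
      by (simp add: c_def powr_powr shell_exponent_def add.commute)
  qed
  have pp: "(\<Prod>j\<in>UNIV. c j powi (\<alpha> $ j)) > 0"
    using c by (intro prod_pos) (simp add: zero_less_power_int)
  have "shell_mass p \<alpha> k m = ennreal (\<Prod>j\<in>UNIV. (c j)\<^sup>2) *
      (\<integral>\<^sup>+z. ennreal (norm (laurent_monomial \<alpha> (dilation c z)) powr p) * indicator (shell k m) (dilation c z) \<partial>lborel)"
    unfolding shell_mass_def by (intro nn_integral_dilation c) measurable
  also have "\<dots> = ennreal (\<Prod>j\<in>UNIV. (c j)\<^sup>2) *
      (\<integral>\<^sup>+z. ennreal ((\<Prod>j\<in>UNIV. c j powi (\<alpha> $ j)) powr p) *
        (ennreal (norm (laurent_monomial \<alpha> z) powr p) * indicator (shell k (\<lambda>_. 0)) z) \<partial>lborel)"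
  proof (rule arg_cong[OF nn_integral_cong])
    fix z :: "complex ^ 'n"
    have "norm (laurent_monomial \<alpha> (dilation c z)) powr p =
        (\<Prod>j\<in>UNIV. c j powi (\<alpha> $ j)) powr p * norm (laurent_monomial \<alpha> z) powr p"
      using pp unfolding laurent_monomial_dilation norm_mult norm_of_real by (simp add: powr_mult)
    then show "ennreal (norm (laurent_monomial \<alpha> (dilation c z)) powr p) * indicator (shell k m) (dilation c z) =
        ennreal ((\<Prod>j\<in>UNIV. c j powi (\<alpha> $ j)) powr p) *
        (ennreal (norm (laurent_monomial \<alpha> z) powr p) * indicator (shell k (\<lambda>_. 0)) z)"
      by (simp add: indicator_def shell ennreal_mult)
  qed
  also have "\<dots> = ennreal ((\<Prod>j\<in>UNIV. (c j)\<^sup>2) * (\<Prod>j\<in>UNIV. c j powi (\<alpha> $ j)) powr p) * shell_mass p \<alpha> k (\<lambda>_. 0)"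
    by (subst nn_integral_cmult) (auto simp: shell_mass_def ennreal_mult prod_nonneg mult.assoc)
  also have "(\<Prod>j\<in>UNIV. c j powi (\<alpha> $ j)) powr p = (\<Prod>j\<in>UNIV. (c j powi (\<alpha> $ j)) powr p)"
    by (rule prod_powr_distrib)
  also have "(\<Prod>j\<in>UNIV. (c j)\<^sup>2) * \<dots> = (\<Prod>j\<in>UNIV. (1/2) powr (real (m j) * shell_exponent p \<alpha> k j))"
    by (simp add: prod.distrib[symmetric] sc)
  finally show ?thesis .
qed

text \<open>Bounds independent of \<open>k\<close>: a positive power of a number below 1 is at most
  that number.\<close>

lemma shell_0_norm:
  assumes k: "\<And>j. 0 < k j" and z: "z \<in> shell k (\<lambda>_. 0)"
  shows "1/2 \<le> norm (z $ j)" "norm (z $ j) < 1"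
proof -
  have *: "1/2 \<le> norm (z $ j) ^ k j" "norm (z $ j) ^ k j < 1"
    using z by (auto simp: shell_def)
  show 1: "norm (z $ j) < 1"
    using *(2) by (meson not_less one_le_power)
  have "norm (z $ j) ^ k j \<le> norm (z $ j) ^ 1"
    using k[of j] 1 by (intro power_decreasing) auto
  with * show "1/2 \<le> norm (z $ j)" by simp
qed

text \<open>Finite, because the base shell lies in a compact polyannulus on which the integrand is
  continuous. Positive, because the shell has nonempty interior and the monomial has no zero on
  it.\<close>

lemma shell_mass_0:
  fixes \<alpha> :: "int ^ 'n::finite"
  assumes k: "\<And>j. 0 < k j"
  shows "shell_mass p \<alpha> k (\<lambda>_. 0) < \<infinity>" and "0 < shell_mass p \<alpha> k (\<lambda>_. 0)"
proof -
  let ?S = "shell k (\<lambda>_. 0)"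
  let ?g = "\<lambda>z. norm (laurent_monomial \<alpha> z) powr p"
  let ?K = "{z::complex ^ 'n. \<forall>j. 1/2 \<le> norm (z $ j) \<and> norm (z $ j) \<le> 1}"
  have sub: "?S \<subseteq> ?K"
    using shell_0_norm[where k = k, OF k] by (auto intro: less_imp_le)
  have bK: "bounded ?K"
  proof (rule boundedI)
    fix z assume "z \<in> ?K"
    then have "(\<Sum>j\<in>UNIV. norm (z $ j)) \<le> (\<Sum>j\<in>(UNIV :: 'n set). 1)"
      by (intro sum_mono) auto
    then show "norm z \<le> real CARD('n)"
      using L2_set_le_sum[of UNIV "\<lambda>j. norm (z $ j)"] by (simp add: norm_vec_def)
  qed
  have nz: "z $ j \<noteq> 0" if "z \<in> ?K" for z j
    using that by (auto dest!: spec[of _ j])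
  have "closed ?K"
    by (intro closed_Collect_all closed_Collect_conj closed_Collect_le continuous_intros)
  then have cK: "compact ?K" using bK by (simp add: compact_eq_bounded_closed)
  have "continuous_on ?K ?g"
    unfolding laurent_monomial_def
    by (intro continuous_intros) (use nz in \<open>auto simp: prod_zero_iff power_int_eq_0_iff\<close>)
  then have "compact (?g ` ?K)" using cK by (rule compact_continuous_image)
  then have "bdd_above (?g ` ?K)"
    by (intro bounded_imp_bdd_above compact_imp_bounded)
  then obtain B where "\<forall>y\<in>?g ` ?K. y \<le> B"
    unfolding bdd_above_def by blast
  then have B: "?g z \<le> B" if "z \<in> ?K" for z
    using that by blast
  have "shell_mass p \<alpha> k (\<lambda>_. 0) \<le> (\<integral>\<^sup>+z. ennreal B * indicator ?S z \<partial>lborel)"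
    unfolding shell_mass_def using B sub
    by (intro nn_integral_mono) (auto simp: indicator_def intro!: ennreal_leI)
  also have "\<dots> = ennreal B * emeasure lborel ?S"
    by (intro nn_integral_cmult_indicator) simp
  also have "\<dots> < \<infinity>"
    using emeasure_bounded_finite[OF bounded_subset[OF bK sub]] by (simp add: ennreal_mult_less_top)
  finally show "shell_mass p \<alpha> k (\<lambda>_. 0) < \<infinity>" .
  let ?U = "{z::complex ^ 'n. \<forall>j. 1/2 < norm (z $ j) ^ k j \<and> norm (z $ j) ^ k j < 1}"
  have "open ((\<lambda>z :: complex ^ 'n. norm (z $ j) ^ k j) -` {1/2<..<1})" for j
    by (intro open_vimage open_greaterThanLessThan continuous_intros)
  then have "open (\<Inter>j. (\<lambda>z :: complex ^ 'n. norm (z $ j) ^ k j) -` {1/2<..<1})"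
    by (intro open_INT) auto
  also have "(\<Inter>j. (\<lambda>z :: complex ^ 'n. norm (z $ j) ^ k j) -` {1/2<..<1}) = ?U"
    by auto
  finally have oU: "open ?U" .
  \<comment> \<open>The value 3/4 of every \<open>norm (z $ j) ^ k j\<close> lies strictly between
    the bounds 1/2 and 1.\<close>
  have "(\<chi> j. of_real ((3/4) powr (1 / k j))) \<in> ?U"
    using k by (auto simp: powr_realpow[symmetric] powr_powr simp del: powr_realpow)
  then have "?U \<noteq> {}" by blast
  with oU have pos: "emeasure lborel ?U \<noteq> 0"
    using open_not_negligible[of ?U] by (auto simp: negligible_iff_null_sets null_sets_def)
  show "0 < shell_mass p \<alpha> k (\<lambda>_. 0)"
  proof (rule ccontr)
    assume "\<not> ?thesis"
    then have "shell_mass p \<alpha> k (\<lambda>_. 0) = 0" by (simp add: not_less)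
    then have "AE z in lborel. ennreal (?g z) * indicator ?S z = 0"
      unfolding shell_mass_def by (subst (asm) nn_integral_0_iff_AE) auto
    then have "AE z in lborel. z \<notin> ?U"
    proof eventually_elim
      case (elim z)
      show ?case
      proof
        assume "z \<in> ?U"
        then have zS: "z \<in> ?S" by (auto simp: shell_def less_imp_le)
        have "laurent_monomial \<alpha> z \<noteq> 0"
          using zS sub nz by (auto simp: laurent_monomial_def power_int_eq_0_iff)
        with elim zS show False by simp
      qed
    qed
    then have "emeasure lborel ?U = 0"
      using oU by (subst (asm) AE_iff_measurable[of ?U]) auto
    with pos show False by contradiction
  qed
qed

section \<open>Dyadic levels and the cover of the domain by shells\<close>

lemma between_powers_of_half:
  fixes t :: real
  assumes "0 < t" "t < 1"
  shows "\<exists>n. (1/2) ^ Suc n \<le> t \<and> t < (1/2) ^ n"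
proof -
  obtain l where "(1/2) ^ l < t"
    using real_arch_pow_inv[OF assms(1), of "1/2"] by auto
  then have "(1/2) ^ Suc l \<le> t"
    using assms(1) by simp
  then have ex: "\<exists>n. (1/2) ^ Suc n \<le> t" ..
  define n where "n = (LEAST n. (1/2) ^ Suc n \<le> t)"
  have "(1/2) ^ Suc n \<le> t"
    unfolding n_def by (rule LeastI_ex[OF ex])
  moreover have "t < (1/2) ^ n"
  proof (cases n)
    case (Suc l)
    then have "\<not> (1/2) ^ Suc l \<le> t"
      using not_less_Least[of l "\<lambda>n. (1/2) ^ Suc n \<le> t"] by (simp add: n_def)
    with Suc show ?thesis by simp
  qed (use assms in simp)
  ultimately show ?thesis by blast
qed

text \<open>Telescoping of the drops of \<open>m\<close> between neighbouring indices. The index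
  type is an abstract finite order, so the induction runs on the number of larger indices.\<close>

lemma antimono_eq_tail_sum:
  fixes m :: "'n::{finite,linorder} \<Rightarrow> nat"
  assumes m: "\<And>i j. i \<le> j \<Longrightarrow> m j \<le> m i"
  shows "\<exists>d. \<forall>j. m j = (\<Sum>i\<in>{j..}. d i)"
proof -
  \<comment> \<open>The drop from \<open>i\<close> to its successor; past the greatest index the
    value counts as 0. Since \<open>m\<close> is antitone, the subtraction is never
    truncated.\<close>
  define d where "d i = m i - (if {i<..} = {} then 0 else m (Min {i<..}))" for i
  have "m j = (\<Sum>i\<in>{j..}. d i)" for j
  proof (induction "card {j<..}" arbitrary: j rule: less_induct)
    case less
    have split: "{j..} = insert j {j<..}" by auto
    show ?case
    proof (cases "{j<..} = {}")
      case True
      then show ?thesis by (simp add: split d_def)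
    next
      case False
      define j' where "j' = Min {j<..}"
      have j': "j < j'" "\<And>i. j < i \<Longrightarrow> j' \<le> i"
        using Min_in[OF _ False] by (auto simp: j'_def)
      then have eq: "{j<..} = {j'..}" by auto
      have "card {j'<..} < card {j<..}"
        using j' by (intro psubset_card_mono) auto
      then have "m j' = (\<Sum>i\<in>{j'..}. d i)" by (rule less)
      moreover have "d j = m j - m j'" using False by (simp add: d_def j'_def)
      moreover have "m j' \<le> m j" using j' by (intro m) simp
      ultimately show ?thesis by (simp add: split eq) (metis eq split finite sum.insert greaterThan_iff less_irrefl le_add_diff_inverse2)
    qed
  qed
  then show ?thesis by blast
qed

text \<open>Summation by parts: both sides sum over the pairs \<open>j \<le> i\<close>. This is
  where the initial segments \<open>{..i}\<close> enter.\<close>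

lemma sum_tail_swap:
  fixes b d :: "'n::{finite,linorder} \<Rightarrow> real"
  shows "(\<Sum>j\<in>UNIV. (\<Sum>i\<in>{j..}. d i) * b j) = (\<Sum>i\<in>UNIV. d i * (\<Sum>j\<in>{..i}. b j))"
proof -
  have "(\<Sum>j\<in>UNIV. (\<Sum>i\<in>{j..}. d i) * b j) = (\<Sum>j\<in>UNIV. \<Sum>i | i \<in> UNIV \<and> j \<le> i. d i * b j)"
    by (simp add: sum_distrib_right atLeast_def)
  also have "\<dots> = (\<Sum>i\<in>UNIV. \<Sum>j | j \<in> UNIV \<and> j \<le> i. d i * b j)"
    by (rule sum.swap_restrict) auto
  also have "\<dots> = (\<Sum>i\<in>UNIV. d i * (\<Sum>j\<in>{..i}. b j))"
    by (simp add: sum_distrib_left atMost_def)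
  finally show ?thesis .
qed

text \<open>Since \<open>norm (z $ j) ^ k j\<close> increases with \<open>j\<close>, its dyadic
  level weakly decreases, hence is a tail sum. Neighbouring levels may coincide, and then the shell
  may stick out of \<open>Omega_C\<close>; a cover suffices for the upper bound.\<close>

lemma nonzero_Omega_C_in_shell:
  fixes k :: "'n::{finite,linorder} \<Rightarrow> nat"
  assumes z: "z \<in> Omega_C k" and nz: "\<And>j. z $ j \<noteq> 0"
  shows "\<exists>d. z \<in> shell k (\<lambda>j. \<Sum>i\<in>{j..}. d i)"
proof -
  let ?t = "\<lambda>j. norm (z $ j) ^ k j"
  have "\<forall>j. \<exists>n. (1/2) ^ Suc n \<le> ?t j \<and> ?t j < (1/2) ^ n"
    using z nz by (intro allI between_powers_of_half) (auto simp: Omega_C_def)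
  then obtain m where m: "\<And>j. (1/2) ^ Suc (m j) \<le> ?t j" "\<And>j. ?t j < (1/2) ^ m j"
    by metis
  have "m j \<le> m i" if "i \<le> j" for i j
  proof -
    have "?t i \<le> ?t j"
      using z that by (auto simp: Omega_C_def dest: strict_mono_mono monoD)
    with m(1)[of i] m(2)[of j] have "(1/2::real) ^ Suc (m i) < (1/2) ^ m j" by linarith
    then have "m j < Suc (m i)" by (subst (asm) power_strict_decreasing_iff) auto
    then show ?thesis by simp
  qed
  then obtain d where "\<And>j. m j = (\<Sum>i\<in>{j..}. d i)"
    using antimono_eq_tail_sum[of m] by blast
  then have "(\<lambda>j. \<Sum>i\<in>{j..}. d i) = m" by auto
  moreover have "z \<in> shell k m" using m by (simp add: shell_def)
  ultimately show ?thesis by metis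
qed

text \<open>A strict drop of the level puts the dyadic intervals of different coordinates in the
  right order. This serves the lower bound, where shells must lie inside the domain.\<close>

lemma shell_subset_Omega_C:
  fixes k :: "'n::{finite,linorder} \<Rightarrow> nat"
  assumes m: "\<And>i j. i < j \<Longrightarrow> m j < m i"
  shows "shell k m \<subseteq> Omega_C k"
proof
  fix z assume z: "z \<in> shell k m"
  have "norm (z $ i) ^ k i < norm (z $ j) ^ k j" if "i < j" for i j
  proof -
    have "norm (z $ i) ^ k i < (1/2) ^ m i" using z by (simp add: shell_def)
    also have "(1/2::real) ^ m i \<le> (1/2) ^ Suc (m j)"
      using m[OF that] by (intro power_decreasing) auto
    also have "\<dots> \<le> norm (z $ j) ^ k j" using z by (simp add: shell_def)
    finally show ?thesis .
  qed
  moreover have "norm (z $ j) ^ k j < 1" for j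
  proof -
    have "norm (z $ j) ^ k j < (1/2) ^ m j" using z by (simp add: shell_def)
    also have "\<dots> \<le> 1" by (simp add: power_le_one)
    finally show ?thesis .
  qed
  ultimately show "z \<in> Omega_C k" by (simp add: Omega_C_def strict_mono_def)
qed

lemma Omega_C_sets [measurable]: "Omega_C k \<in> sets borel"
  unfolding Omega_C_def strict_mono_def by measurable

lemma null_coordinate: "emeasure lborel {z :: complex ^ 'n::finite. z $ j = 0} = 0"
proof -
  \<comment> \<open>The inner product with \<open>axis j 1\<close> is the real part of
    \<open>z $ j\<close>, so a real hyperplane contains the complex one.\<close>
  have "{z :: complex ^ 'n. z $ j = 0} \<subseteq> {z. axis j 1 \<bullet> z = 0}"
    by (auto simp: inner_axis')
  moreover have "negligible {z :: complex ^ 'n. axis j 1 \<bullet> z = 0}"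
    by (intro negligible_hyperplane) (simp add: axis_eq_0_iff)
  ultimately have "negligible {z :: complex ^ 'n. z $ j = 0}"
    by (rule negligible_subset[rotated])
  moreover have "{z :: complex ^ 'n. z $ j = 0} \<in> sets borel" by measurable
  ultimately show ?thesis
    by (simp add: negligible_iff_null_sets null_sets_def)
qed

lemma AE_coordinates_nonzero: "AE z in (lborel :: (complex ^ 'n::finite) measure). \<forall>j. z $ j \<noteq> 0"
proof -
  have "AE z in (lborel :: (complex ^ 'n) measure). z $ j \<noteq> 0" for j
    using null_coordinate[of j] by (subst AE_iff_measurable[of "{z. z $ j = 0}"]) auto
  then show ?thesis by (subst AE_all_countable) auto
qed

section \<open>Integrability over the domain\<close>

text \<open>The decay rate in the free parameter \<open>d i\<close>: raising \<open>d i\<close> by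
  one raises the levels of all \<open>j \<le> i\<close> by one.\<close>

definition cone_exponent :: "real \<Rightarrow> int ^ 'n::{finite,linorder} \<Rightarrow> ('n::{finite,linorder} \<Rightarrow> nat) \<Rightarrow> 'n::{finite,linorder} \<Rightarrow> real" where
  "cone_exponent p \<alpha> k i = (\<Sum>j\<in>{..i}. shell_exponent p \<alpha> k j)"

lemma shell_mass_tail_sum:
  fixes k :: "'n::{finite,linorder} \<Rightarrow> nat"
  assumes k: "\<And>j. 0 < k j"
  shows "shell_mass p \<alpha> k (\<lambda>j. \<Sum>i\<in>{j..}. d i) =
    ennreal (\<Prod>i\<in>UNIV. ((1/2) powr cone_exponent p \<alpha> k i) ^ d i) * shell_mass p \<alpha> k (\<lambda>_. 0)"
proof -
  have "(\<Prod>j\<in>UNIV. (1/2::real) powr (real (\<Sum>i\<in>{j..}. d i) * shell_exponent p \<alpha> k j)) =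
      (1/2) powr (\<Sum>j\<in>UNIV. (\<Sum>i\<in>{j..}. real (d i)) * shell_exponent p \<alpha> k j)"
    by (subst powr_sum) auto
  also have "\<dots> = (1/2) powr (\<Sum>i\<in>UNIV. real (d i) * cone_exponent p \<alpha> k i)"
    unfolding sum_tail_swap cone_exponent_def ..
  also have "\<dots> = (\<Prod>i\<in>UNIV. (1/2) powr (real (d i) * cone_exponent p \<alpha> k i))"
    by (subst powr_sum) auto
  also have "\<dots> = (\<Prod>i\<in>UNIV. ((1/2) powr cone_exponent p \<alpha> k i) ^ d i)"
    by (intro prod.cong refl) (simp add: powr_powr mult.commute flip: powr_realpow)
  finally show ?thesis
    using shell_mass_scaling[of k p \<alpha> "\<lambda>j. \<Sum>i\<in>{j..}. d i", OF k] by simp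
qed

text \<open>If all exponents are positive, the cover bounds the integral by a convergent product of
  geometric series. If the \<open>i\<close>-th is not, letting only \<open>d i\<close> grow gives
  infinitely many disjoint shells inside the domain with masses bounded away from 0.\<close>

lemma nn_integral_Omega_C_finite_iff:
  fixes k :: "'n::{finite,linorder} \<Rightarrow> nat" and \<alpha> :: "int ^ 'n::{finite,linorder}"
  assumes k: "\<And>j. 0 < k j"
  shows "(\<integral>\<^sup>+z\<in>Omega_C k. ennreal (norm (laurent_monomial \<alpha> z) powr p) \<partial>lborel) < \<infinity> \<longleftrightarrow>
    (\<forall>i. 0 < cone_exponent p \<alpha> k i)" (is "?I < \<infinity> \<longleftrightarrow> _")
proof
  let ?g = "\<lambda>z. ennreal (norm (laurent_monomial \<alpha> z) powr p)"
  let ?c = "cone_exponent p \<alpha> k"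
  let ?sh = "\<lambda>d :: 'n \<Rightarrow> nat. shell k (\<lambda>j. \<Sum>i\<in>{j..}. d i)"
  assume pos: "\<forall>i. 0 < ?c i"
  \<comment> \<open>Almost every point of the domain has nonzero coordinates and so lies in some
    shell, whose term alone dominates the integrand.\<close>
  have "?I \<le> (\<integral>\<^sup>+z. (\<integral>\<^sup>+d. ?g z * indicator (?sh d) z \<partial>count_space UNIV) \<partial>lborel)"
  proof (rule nn_integral_mono_AE)
    show "AE z in lborel. ?g z * indicator (Omega_C k) z \<le> (\<integral>\<^sup>+d. ?g z * indicator (?sh d) z \<partial>count_space UNIV)"
      using AE_coordinates_nonzero
    proof eventually_elim
      case (elim z)
      show ?case
      proof (cases "z \<in> Omega_C k")
        case True
        with elim obtain d where d: "z \<in> ?sh d" using nonzero_Omega_C_in_shell by blast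
        have "?g z * indicator (Omega_C k) z \<le> (\<integral>\<^sup>+d'. ?g z * indicator (?sh d') z * indicator {d} d' \<partial>count_space UNIV)"
          using d True by simp
        also have "\<dots> \<le> (\<integral>\<^sup>+d'. ?g z * indicator (?sh d') z \<partial>count_space UNIV)"
          by (intro nn_integral_mono) (auto simp: indicator_def)
        finally show ?thesis .
      qed simp
    qed
  qed
  also have "\<dots> = (\<integral>\<^sup>+d. shell_mass p \<alpha> k (\<lambda>j. \<Sum>i\<in>{j..}. d i) \<partial>count_space UNIV)"
    unfolding shell_mass_def by (intro nn_integral_count_space_nn_integral) auto
  also have "\<dots> = (\<integral>\<^sup>+d. ennreal (\<Prod>i\<in>UNIV. ((1/2) powr ?c i) ^ d i) \<partial>count_space UNIV) * shell_mass p \<alpha> k (\<lambda>_. 0)"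
    unfolding shell_mass_tail_sum[OF k] by (intro nn_integral_multc) auto
  also have "\<dots> < \<infinity>"
    using shell_mass_0(1)[OF k, of p \<alpha>] pos
    by (subst infinity_ennreal_def)
       (intro ennreal_mult_less_top[THEN iffD2] disjI2 conjI nn_integral_prod_geometric_finite[unfolded infinity_ennreal_def],
        auto simp: powr_divide gr_one_powr)
  finally show "?I < \<infinity>" .
next
  let ?g = "\<lambda>z. ennreal (norm (laurent_monomial \<alpha> z) powr p)"
  assume fin: "?I < \<infinity>"
  show "\<forall>i. 0 < cone_exponent p \<alpha> k i"
  proof (rule allI, rule ccontr)
    fix i assume neg: "\<not> 0 < cone_exponent p \<alpha> k i"
    \<comment> \<open>The entries are at least 1, so that the levels drop strictly and the shells
      lie in \<open>Omega_C\<close>; only entry \<open>i\<close> varies with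
      \<open>N\<close>.\<close>
    define d where "d N l = (if l = i then Suc N else 1)" for N :: nat and l
    define m where "m N j = (\<Sum>l\<in>{j..}. d N l)" for N j
    have "m N b < m N a" if "a < b" for N a b
    proof -
      have "m N b < m N b + d N a" by (simp add: d_def)
      also have "\<dots> = (\<Sum>l\<in>insert a {b..}. d N l)" using that by (simp add: m_def)
      also have "\<dots> \<le> m N a" unfolding m_def using that by (intro sum_mono2) auto
      finally show ?thesis .
    qed
    then have sub: "shell k (m N) \<subseteq> Omega_C k" for N by (rule shell_subset_Omega_C)
    define C where "C = shell_mass p \<alpha> k (m 0)"
    have C: "0 < C"
      unfolding C_def m_def shell_mass_tail_sum[OF k] using shell_mass_0(2)[OF k, of p \<alpha>]
      by (auto simp: ennreal_zero_less_mult_iff intro!: prod_pos)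
    \<comment> \<open>Only the factor at \<open>i\<close> depends on \<open>N\<close>, and its base
      is at least 1 because its exponent is not positive.\<close>
    have mass: "C \<le> shell_mass p \<alpha> k (m N)" for N
      unfolding C_def m_def shell_mass_tail_sum[OF k]
    proof (intro mult_right_mono ennreal_leI prod_mono conjI)
      fix l
      have "(1/2 :: real) powr 0 \<le> (1/2) powr cone_exponent p \<alpha> k i"
        using neg by (intro powr_mono') auto
      then have "1 \<le> (1/2 :: real) powr cone_exponent p \<alpha> k i" by simp
      then show "((1/2) powr cone_exponent p \<alpha> k l) ^ d 0 l \<le> ((1/2) powr cone_exponent p \<alpha> k l) ^ d N l"
        using power_increasing[of 1 "Suc N"] unfolding d_def by (auto simp del: power_Suc)
    qed auto
    \<comment> \<open>The level of coordinate \<open>i\<close> grows with \<open>N\<close>, so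
      different shells already have disjoint ranges in that coordinate.\<close>
    have m_inj: "m N i < m N' i" if "N < N'" for N N'
    proof -
      have eq: "m N i = d N i + (\<Sum>l\<in>{i<..}. d N l)" for N
      proof -
        have "{i..} = insert i {i<..}" by auto
        then show ?thesis by (simp add: m_def)
      qed
      have "(\<Sum>l\<in>{i<..}. d N l) = (\<Sum>l\<in>{i<..}. d N' l)"
        by (intro sum.cong) (auto simp: d_def)
      then show ?thesis using that by (simp add: eq) (simp add: d_def)
    qed
    have disj_less: "shell k (m N) \<inter> shell k (m N') = {}" if "N < N'" for N N'
    proof -
      have "False" if z: "z \<in> shell k (m N)" "z \<in> shell k (m N')" for z
      proof -
        have "(1/2 :: real) ^ Suc (m N i) < (1/2) ^ m N' i"
          using z by (auto simp: shell_def intro: le_less_trans)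
        then have "m N' i < Suc (m N i)" by (subst (asm) power_strict_decreasing_iff) auto
        with m_inj[OF \<open>N < N'\<close>] show False by simp
      qed
      then show ?thesis by blast
    qed
    have disj: "disjoint_family_on (\<lambda>N. shell k (m N)) S" for S
      unfolding disjoint_family_on_def using disj_less by (metis Int_commute linorder_neqE_nat)
    have bound: "of_nat N * C \<le> ?I" for N
    proof -
      have "of_nat N * C \<le> (\<Sum>n<N. shell_mass p \<alpha> k (m n))"
        using sum_mono[of "{..<N}" "\<lambda>_. C"] mass by simp
      also have "\<dots> = (\<Sum>n<N. \<integral>\<^sup>+z\<in>shell k (m n). ?g z \<partial>lborel)"
        by (simp add: shell_mass_def)
      also have "\<dots> = (\<Sum>n<N. emeasure (density lborel ?g) (shell k (m n)))"
        by (simp add: emeasure_density)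
      also have "\<dots> = emeasure (density lborel ?g) (\<Union>n<N. shell k (m n))"
        by (intro sum_emeasure disj) auto
      also have "\<dots> \<le> emeasure (density lborel ?g) (Omega_C k)"
        using sub by (intro emeasure_mono) auto
      also have "\<dots> = ?I" by (simp add: emeasure_density)
      finally show ?thesis .
    qed
    have "C < \<infinity>" using bound[of 1] fin by (auto intro: le_less_trans)
    from C this obtain c where c: "C = ennreal c" "c > 0"
      by (cases C) auto
    from fin obtain I where I: "?I = ennreal I" "I \<ge> 0"
      by (cases ?I) auto
    obtain N :: nat where "I / c < N" using reals_Archimedean2 by blast
    then have "I < N * c" using c by (simp add: field_simps)
    moreover have "N * c \<le> I"
      using bound[of N] c I by (simp add: ennreal_of_nat_eq_real_of_nat flip: ennreal_mult)
    ultimately show False by simp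
  qed
qed

section \<open>From integrability to allowable indices\<close>

lemma polar_locus_sets [measurable]: "polar_locus \<alpha> \<in> sets borel"
  unfolding polar_locus_def by measurable

text \<open>A negative \<open>powi\<close> of 0 is 0 by convention, so removing the polar locus
  leaves integrals of the monomial unchanged pointwise.\<close>

lemma laurent_monomial_polar_locus: "z \<in> polar_locus \<alpha> \<Longrightarrow> laurent_monomial \<alpha> z = 0"
  by (auto simp: polar_locus_def laurent_monomial_def power_int_0_left_if)

text \<open>The product rule. Negative exponents have a nonzero base off the polar locus;
  nonnegative ones are treated as ordinary powers because their coordinate may vanish.\<close>

lemma holomorphic_laurent_monomial:
  "holomorphic_vec_on (laurent_monomial \<alpha>) (\<Omega> - polar_locus \<alpha>)"
  unfolding holomorphic_vec_on_def
proof
  fix z assume z: "z \<in> \<Omega> - polar_locus \<alpha>"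
  let ?S = "\<Omega> - polar_locus \<alpha>"
  have nth: "((\<lambda>z. z $ j) has_derivative (\<lambda>h. h $ j)) (at z within ?S)" for j
    by (intro bounded_linear_imp_has_derivative bounded_linear_vec_nth)
  have "\<exists>d. ((\<lambda>z. (z $ j) powi (\<alpha> $ j)) has_derivative (\<lambda>h. h $ j * d)) (at z within ?S)" for j
  proof (cases "\<alpha> $ j < 0")
    case True
    with z have "z $ j \<noteq> 0" by (auto simp: polar_locus_def)
    then show ?thesis using has_derivative_power_int[OF _ nth] by blast
  next
    case False
    have "((\<lambda>z. (z $ j) ^ nat (\<alpha> $ j)) has_derivative
        (\<lambda>h. h $ j * (of_nat (nat (\<alpha> $ j)) * (z $ j) ^ (nat (\<alpha> $ j) - 1)))) (at z within ?S)"
      using has_derivative_power[OF nth, of j "nat (\<alpha> $ j)"] by (simp add: mult_ac)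
    with False show ?thesis by (auto simp: power_int_def)
  qed
  then obtain d where d: "\<And>j. ((\<lambda>z. (z $ j) powi (\<alpha> $ j)) has_derivative (\<lambda>h. h $ j * d j)) (at z within ?S)"
    by metis
  have "(laurent_monomial \<alpha> has_derivative
      (\<lambda>h. \<Sum>j\<in>UNIV. h $ j * d j * (\<Prod>i\<in>UNIV - {j}. (z $ i) powi (\<alpha> $ i)))) (at z within ?S)"
    unfolding laurent_monomial_def[abs_def] by (intro has_derivative_prod d)
  then have "(laurent_monomial \<alpha> has_derivative
      (\<lambda>h. \<Sum>j\<in>UNIV. (\<chi> j. d j * (\<Prod>i\<in>UNIV - {j}. (z $ i) powi (\<alpha> $ i))) $ j * h $ j)) (at z within ?S)"
    by (simp add: mult_ac)
  then show "\<exists>c. (laurent_monomial \<alpha> has_derivative (\<lambda>h. \<Sum>j\<in>UNIV. c $ j * h $ j)) (at z within ?S)"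
    by blast
qed

text \<open>For \<open>p \<ge> 1\<close> one has \<open>t \<le> 1 + t powr p\<close>, and the
  constant 1 is integrable over a compact set.\<close>

lemma locally_integrable_laurent_monomial:
  assumes "1 \<le> p" and int: "set_integrable lborel (\<Omega> - polar_locus \<alpha>) (\<lambda>z. norm (laurent_monomial \<alpha> z) powr p)"
  shows "locally_integrable_on (laurent_monomial \<alpha>) \<Omega>"
  unfolding locally_integrable_on_def
proof (intro allI impI)
  fix C assume C: "compact C \<and> C \<subseteq> \<Omega>"
  then have [measurable]: "C \<in> sets borel" by (simp add: borel_compact)
  have "integrable lborel (indicator C :: _ \<Rightarrow> real)"
    using C emeasure_bounded_finite[OF compact_imp_bounded, of C] by (intro integrable_real_indicator) auto
  then have "integrable lborel (\<lambda>z. indicator C z + indicator (\<Omega> - polar_locus \<alpha>) z *\<^sub>R norm (laurent_monomial \<alpha> z) powr p)"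
    using int unfolding set_integrable_def by (intro Bochner_Integration.integrable_add) auto
  then show "set_integrable lborel C (laurent_monomial \<alpha>)"
    unfolding set_integrable_def
  proof (rule Bochner_Integration.integrable_bound)
    have "norm (laurent_monomial \<alpha> z) \<le> 1 + norm (laurent_monomial \<alpha> z) powr p" for z
    proof (cases "norm (laurent_monomial \<alpha> z) \<le> 1")
      case False
      then have "norm (laurent_monomial \<alpha> z) powr 1 \<le> norm (laurent_monomial \<alpha> z) powr p"
        using \<open>1 \<le> p\<close> by (intro powr_mono) auto
      with False show ?thesis by simp
    qed (simp add: add_increasing2)
    then show "AE z in lborel. norm (indicator C z *\<^sub>R laurent_monomial \<alpha> z) \<le>
        norm (indicator C z + indicator (\<Omega> - polar_locus \<alpha>) z *\<^sub>R norm (laurent_monomial \<alpha> z) powr p)"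
      using C laurent_monomial_polar_locus[of _ \<alpha>] by (auto simp: indicator_def)
  qed measurable
qed

text \<open>Holomorphy is automatic and local integrability follows from the Bergman condition, so
  only the integral decides.\<close>

lemma allowable_indices_iff:
  fixes k :: "'n::{finite,linorder} \<Rightarrow> nat"
  assumes k: "\<And>j. 0 < k j" and p: "1 \<le> p"
  shows "\<alpha> \<in> allowable_indices p (Omega_C k) \<longleftrightarrow> (\<forall>i. 0 < cone_exponent p \<alpha> k i)"
proof -
  let ?g = "\<lambda>z. norm (laurent_monomial \<alpha> z) powr p"
  have "set_integrable lborel (Omega_C k - polar_locus \<alpha>) ?g \<longleftrightarrow>
      (\<integral>\<^sup>+z. ennreal (norm (indicator (Omega_C k - polar_locus \<alpha>) z *\<^sub>R ?g z)) \<partial>lborel) < \<infinity>"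
    unfolding set_integrable_def by (subst integrable_iff_bounded) auto
  also have "(\<integral>\<^sup>+z. ennreal (norm (indicator (Omega_C k - polar_locus \<alpha>) z *\<^sub>R ?g z)) \<partial>lborel) =
      (\<integral>\<^sup>+z\<in>Omega_C k. ennreal (?g z) \<partial>lborel)"
    by (intro nn_integral_cong) (auto simp: indicator_def laurent_monomial_polar_locus)
  also have "\<dots> < \<infinity> \<longleftrightarrow> (\<forall>i. 0 < cone_exponent p \<alpha> k i)"
    by (rule nn_integral_Omega_C_finite_iff[OF k])
  finally have int_iff: "set_integrable lborel (Omega_C k - polar_locus \<alpha>) ?g \<longleftrightarrow> (\<forall>i. 0 < cone_exponent p \<alpha> k i)" .
  show ?thesis
    unfolding allowable_indices_def bergman_space_def int_iff[symmetric]
    using locally_integrable_laurent_monomial[OF p] holomorphic_laurent_monomial by blast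
qed

section \<open>The conditions in integer form\<close>

lemma K_num_real:
  assumes "j \<le> i" "0 < k j"
  shows "real (K_num k j i) = real (\<Prod>l\<in>{..i}. k l) / real (k j)"
  unfolding K_num_def using assms by (intro real_of_nat_div dvd_prodI) auto

lemma K_num_pos:
  fixes k :: "'n::{finite,linorder} \<Rightarrow> nat"
  assumes k: "\<And>j. 0 < k j" and "j \<le> i"
  shows "0 < K_num k j i"
proof -
  have "0 < real (K_num k j i)"
    unfolding K_num_real[where k = k, OF assms(2) k] using k by (simp add: prod_pos)
  then show ?thesis by simp
qed

text \<open>Clears denominators: \<open>K_num k j i\<close> is the product of the \<open>k l\<close>
  over \<open>{..i}\<close> times \<open>1 / k j\<close>.\<close>

lemma K_num_sum:
  fixes k :: "'n::{finite,linorder} \<Rightarrow> nat"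
  assumes k: "\<And>j. 0 < k j"
  shows "(\<Sum>j\<in>{..i}. real (K_num k j i) * real_of_int (\<alpha> $ j)) * p + 2 * (\<Sum>j\<in>{..i}. real (K_num k j i)) =
    real (\<Prod>l\<in>{..i}. k l) * cone_exponent p \<alpha> k i"
proof -
  have "(\<Sum>j\<in>{..i}. real (K_num k j i) * real_of_int (\<alpha> $ j)) * p + 2 * (\<Sum>j\<in>{..i}. real (K_num k j i)) =
      (\<Sum>j\<in>{..i}. real (K_num k j i) * (real_of_int (\<alpha> $ j) * p + 2))"
    by (simp add: sum_distrib_right sum_distrib_left sum.distrib[symmetric] algebra_simps)
  also have "\<dots> = (\<Sum>j\<in>{..i}. real (\<Prod>l\<in>{..i}. k l) * shell_exponent p \<alpha> k j)"
    by (intro sum.cong refl) (simp add: K_num_real k shell_exponent_def)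
  finally show ?thesis by (simp only: cone_exponent_def sum_distrib_left)
qed

lemma allowable_indices_Omega_C:
  fixes k :: "'n::{finite,linorder} \<Rightarrow> nat"
  assumes k: "\<And>j. 0 < k j" and p: "1 \<le> p"
  shows "allowable_indices p (Omega_C k) =
    {\<alpha>. \<forall>i. (\<Sum>j\<in>{..i}. real (K_num k j i) * real_of_int (\<alpha> $ j)) * p > - 2 * (\<Sum>j\<in>{..i}. real (K_num k j i))}"
proof (intro set_eqI)
  fix \<alpha>
  have "0 < cone_exponent p \<alpha> k i \<longleftrightarrow>
      (\<Sum>j\<in>{..i}. real (K_num k j i) * real_of_int (\<alpha> $ j)) * p > - 2 * (\<Sum>j\<in>{..i}. real (K_num k j i))" for i
  proof -
    have "0 < real (\<Prod>l\<in>{..i}. k l)" using k by (simp add: prod_pos)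
    then have "0 < cone_exponent p \<alpha> k i \<longleftrightarrow> 0 < real (\<Prod>l\<in>{..i}. k l) * cone_exponent p \<alpha> k i"
      by (simp add: zero_less_mult_iff)
    then show ?thesis unfolding K_num_sum[of k, OF k, symmetric] by linarith
  qed
  then show "\<alpha> \<in> allowable_indices p (Omega_C k) \<longleftrightarrow> \<alpha> \<in> {\<alpha>. \<forall>i. (\<Sum>j\<in>{..i}. real (K_num k j i) * real_of_int (\<alpha> $ j)) * p > - 2 * (\<Sum>j\<in>{..i}. real (K_num k j i))}"
    unfolding allowable_indices_iff[OF k p] by simp
qed

text \<open>Iterates the two-term identity: the old coefficients are multiplied by \<open>y\<close>
  and the new element gets \<open>x\<close>.\<close>

lemma bezout_Gcd_image:
  fixes f :: "'a \<Rightarrow> nat"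
  assumes "finite B"
  shows "\<exists>u. (\<Sum>j\<in>B. int (f j) * u j) = int (Gcd (f ` B))"
  using assms
proof (induction B)
  case (insert b B)
  then obtain u where u: "(\<Sum>j\<in>B. int (f j) * u j) = int (Gcd (f ` B))" by blast
  obtain x y where xy: "x * int (f b) + y * int (Gcd (f ` B)) = gcd (int (f b)) (int (Gcd (f ` B)))"
    using bezout_int by blast
  define v where "v j = (if j = b then x else y * u j)" for j
  have "(\<Sum>j\<in>B. int (f j) * v j) = (\<Sum>j\<in>B. y * (int (f j) * u j))"
    using insert.hyps by (intro sum.cong) (auto simp: v_def)
  also have "\<dots> = y * int (Gcd (f ` B))" by (simp add: u flip: sum_distrib_left)
  finally have "(\<Sum>j\<in>insert b B. int (f j) * v j) = int (Gcd (f ` insert b B))"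
    using insert.hyps xy by (simp add: v_def mult.commute)
  then show ?case by blast
qed auto

text \<open>Kept integer valued for divisibility: for positive \<open>k\<close>, its values over all
  \<alpha> are exactly the multiples of \<open>m_gcd k i\<close>, by
  \<open>m_gcd_dvd_degree_form\<close> and \<open>degree_form_witness\<close>.\<close>

definition degree_form :: "('n::{finite,linorder} \<Rightarrow> nat) \<Rightarrow> int ^ 'n::{finite,linorder} \<Rightarrow> 'n \<Rightarrow> int"
  where "degree_form k \<alpha> i = (\<Sum>j\<in>{..i}. int (K_num k j i) * \<alpha> $ j)"

lemma m_gcd_dvd_K_num: "j \<le> i \<Longrightarrow> m_gcd k i dvd K_num k j i"
  by (auto simp: m_gcd_def intro: Gcd_dvd)

lemma m_gcd_pos:
  assumes "\<And>j. 0 < k j"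
  shows "0 < m_gcd k i"
  using m_gcd_dvd_K_num[of i i k] K_num_pos[of k i i, OF assms] by (auto intro: Nat.gr0I)

text \<open>The gcd divides every summand. Integrality is what allows the case split at
  \<open>- L\<close> in \<open>eventually_int_constraint_eq\<close>.\<close>

lemma L_num_int:
  fixes k :: "'n::{finite,linorder} \<Rightarrow> nat"
  assumes k: "\<And>j. 0 < k j"
  obtains L :: int where "L_num k i = real_of_int L" "0 < L"
proof -
  have "m_gcd k i dvd (\<Sum>j\<in>{..i}. K_num k j i)"
    by (intro dvd_sum) (auto intro: m_gcd_dvd_K_num)
  then obtain s where s: "(\<Sum>j\<in>{..i}. K_num k j i) = m_gcd k i * s" ..
  have "0 < (\<Sum>j\<in>{..i}. K_num k j i)"
    by (intro sum_pos) (auto intro: K_num_pos k)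
  with s have "0 < s" by (auto intro: Nat.gr0I)
  have m: "0 < m_gcd k i" by (rule m_gcd_pos[OF k])
  have "(\<Sum>j\<in>{..i}. real (K_num k j i)) = real (m_gcd k i) * real s"
    unfolding of_nat_sum[symmetric] s by simp
  with \<open>0 < s\<close> m show thesis
    by (intro that[of "2 * int s"]) (auto simp: L_num_def)
qed

lemma m_gcd_dvd_degree_form: "int (m_gcd k i) dvd degree_form k \<alpha> i"
  unfolding degree_form_def by (intro dvd_sum dvd_mult2) (simp add: m_gcd_dvd_K_num)

text \<open>Dividing the \<open>i\<close>-th condition by the positive \<open>m_gcd k i\<close>
  leaves an integer coefficient of \<open>p\<close>.\<close>

lemma mem_allowable_indices_iff:
  fixes k :: "'n::{finite,linorder} \<Rightarrow> nat"
  assumes k: "\<And>j. 0 < k j" and p: "1 \<le> p"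
  shows "\<alpha> \<in> allowable_indices p (Omega_C k) \<longleftrightarrow>
    (\<forall>i. real_of_int (degree_form k \<alpha> i div int (m_gcd k i)) * p > - L_num k i)"
proof -
  have "(\<Sum>j\<in>{..i}. real (K_num k j i) * real_of_int (\<alpha> $ j)) * p > - 2 * (\<Sum>j\<in>{..i}. real (K_num k j i)) \<longleftrightarrow>
      real_of_int (degree_form k \<alpha> i div int (m_gcd k i)) * p > - L_num k i" for i
  proof -
    define a where "a = degree_form k \<alpha> i div int (m_gcd k i)"
    have m: "0 < real (m_gcd k i)" using m_gcd_pos[of k i, OF k] by simp
    have "degree_form k \<alpha> i = int (m_gcd k i) * a"
      using m_gcd_dvd_degree_form[of k i \<alpha>] by (simp add: a_def)
    then have "real_of_int (degree_form k \<alpha> i) = real (m_gcd k i) * real_of_int a" by simp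
    then have "(\<Sum>j\<in>{..i}. real (K_num k j i) * real_of_int (\<alpha> $ j)) = real (m_gcd k i) * real_of_int a"
      by (simp add: degree_form_def)
    moreover have "2 * (\<Sum>j\<in>{..i}. real (K_num k j i)) = real (m_gcd k i) * L_num k i"
      using m by (simp add: L_num_def)
    moreover have "real (m_gcd k i) * real_of_int a * p > - (real (m_gcd k i) * L_num k i) \<longleftrightarrow> real_of_int a * p > - L_num k i"
      using mult_less_cancel_left_pos[OF m, of "- L_num k i" "real_of_int a * p"] by (simp add: mult.assoc)
    ultimately show ?thesis unfolding a_def[symmetric] by simp
  qed
  then show ?thesis by (simp add: allowable_indices_Omega_C[OF k p])
qed

section \<open>Threshold exponents\<close>

text \<open>For exponents at least 1 the constraint always holds if \<open>a \<ge> 0\<close> and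
  always fails if \<open>a \<le> - L\<close>. The finitely many remaining \<open>a\<close> switch
  only at \<open>L / (- a)\<close>, and \<open>p\<close> has positive distance from these
  points.\<close>

lemma eventually_int_constraint_eq:
  fixes L :: int and p :: real
  assumes p: "1 \<le> p" and L: "0 < L"
    and not: "\<And>l. 1 \<le> l \<Longrightarrow> l \<le> L - 1 \<Longrightarrow> p \<noteq> L / l"
  shows "eventually (\<lambda>q. 1 \<le> q \<longrightarrow> (\<forall>a::int. a * q > - L \<longleftrightarrow> a * p > - L)) (nhds p)"
proof -
  have "eventually (\<lambda>q. \<forall>l\<in>{1..L - 1}. q < L / l \<longleftrightarrow> p < L / l) (nhds p)"
  proof (intro eventually_ball_finite ballI)
    fix l assume "l \<in> {1..L - 1}"
    with not[of l] consider "p < L / l" | "p > L / l" by fastforce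
    then show "eventually (\<lambda>q. q < L / l \<longleftrightarrow> p < L / l) (nhds p)"
    proof cases
      case 1
      then show ?thesis using eventually_nhds_in_open[of "{..<L / l}" p] by (simp add: eventually_mono)
    next
      case 2
      have "eventually (\<lambda>q. q \<in> {L / l<..}) (nhds p)"
        using 2 by (intro eventually_nhds_in_open) auto
      then show ?thesis using 2 by (auto elim: eventually_mono)
    qed
  qed simp
  then show ?thesis
  proof eventually_elim
    case (elim q)
    show ?case
    proof (intro impI allI)
      fix a :: int assume q: "1 \<le> q"
      consider "0 \<le> a" | "a \<le> - L" | "1 \<le> - a" "- a \<le> L - 1" by linarith
      then show "a * q > - L \<longleftrightarrow> a * p > - L"
      proof cases
        case 1
        then have "0 \<le> a * q" "0 \<le> a * p" using p q by auto
        with L show ?thesis by linarith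
      next
        case 2
        have "a * r \<le> - L" if "1 \<le> r" for r :: real
        proof -
          have "a * r \<le> real_of_int a * 1" using that 2 L by (intro mult_left_mono_neg) auto
          with 2 show ?thesis by linarith
        qed
        with p q show ?thesis by (meson not_less)
      next
        case 3
        then have "real_of_int (- a) > 0" by linarith
        then have "a * r > - L \<longleftrightarrow> r < L / real_of_int (- a)" for r :: real
          unfolding pos_less_divide_eq[OF \<open>real_of_int (- a) > 0\<close>] by (simp add: mult.commute) linarith
        moreover have "q < L / real_of_int (- a) \<longleftrightarrow> p < L / real_of_int (- a)"
          using 3 elim by (intro elim[THEN bspec]) auto
        ultimately show ?thesis by blast
      qed
    qed
  qed
qed

text \<open>
  A Bezout solution is shifted along the kernel of the
  \<open>i\<close>-th form to make the earlier entries nonnegative, and the later entries are taken large.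
\<close>
lemma degree_form_witness:
  fixes k :: "'n::{finite,linorder} \<Rightarrow> nat"
  assumes k: "\<And>j. 0 < k j"
  shows "\<exists>\<alpha>. degree_form k \<alpha> i = l * int (m_gcd k i) \<and> (\<forall>i'. i' \<noteq> i \<longrightarrow> 0 \<le> degree_form k \<alpha> i')"
proof -
  have K: "1 \<le> int (K_num k j i)" if "j \<le> i" for i j
    using K_num_pos[of k j i, OF k that] by linarith
  obtain u where u: "(\<Sum>j\<in>{..i}. int (K_num k j i) * u j) = int (m_gcd k i)"
    unfolding m_gcd_def using bezout_Gcd_image[of "{..i}" "\<lambda>j. K_num k j i"] by auto
  \<comment> \<open>Bounds every \<open>l * u j\<close> in absolute value; as
    \<open>K_num k i i\<close> is at least 1, the shift by \<open>t * K_num k i i\<close> makes the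
    earlier entries nonnegative.\<close>
  define t where "t = (\<Sum>j\<in>UNIV. \<bar>l * u j\<bar>)"
  define a where "a j = (if j = i then l * u i - t * (\<Sum>j\<in>{..<i}. int (K_num k j i))
    else l * u j + t * int (K_num k i i))" for j
  \<comment> \<open>Bounds what the entries up to \<open>i\<close> contribute to any form. In a
    later form a single entry \<open>N\<close> with coefficient at least 1 compensates for
    it.\<close>
  define N where "N = (\<Sum>i'\<in>UNIV. \<bar>\<Sum>j\<in>{..i}. int (K_num k j i') * a j\<bar>)"
  define \<alpha> where "\<alpha> = (\<chi> j. if j \<le> i then a j else N)"
  have split: "{..i} = insert i {..<i}" by auto
  have t: "\<bar>l * u j\<bar> \<le> t" for j unfolding t_def by (intro member_le_sum) auto
  have a_nonneg: "0 \<le> a j" if "j < i" for j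
  proof -
    have "t * 1 \<le> t * int (K_num k i i)"
      using K[of i i] t[of j] by (intro mult_left_mono) auto
    with t[of j] have "0 \<le> l * u j + t * int (K_num k i i)" by linarith
    with that show ?thesis by (simp add: a_def)
  qed
  have "degree_form k \<alpha> i = (\<Sum>j\<in>{..i}. int (K_num k j i) * a j)"
    unfolding degree_form_def by (intro sum.cong) (auto simp: \<alpha>_def)
  also have "\<dots> = int (K_num k i i) * a i + (\<Sum>j\<in>{..<i}. int (K_num k j i) * a j)"
    by (simp add: split)
  also have "(\<Sum>j\<in>{..<i}. int (K_num k j i) * a j) =
      (\<Sum>j\<in>{..<i}. l * (int (K_num k j i) * u j) + t * int (K_num k i i) * int (K_num k j i))"
    by (intro sum.cong) (auto simp: a_def algebra_simps)
  also have "\<dots> = l * (\<Sum>j\<in>{..<i}. int (K_num k j i) * u j) +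
      t * int (K_num k i i) * (\<Sum>j\<in>{..<i}. int (K_num k j i))"
    by (simp only: sum.distrib sum_distrib_left)
  also have "int (K_num k i i) * a i + \<dots> = l * (\<Sum>j\<in>{..i}. int (K_num k j i) * u j)"
    by (simp add: split a_def algebra_simps)
  finally have "degree_form k \<alpha> i = l * int (m_gcd k i)" by (simp add: u)
  moreover have "0 \<le> degree_form k \<alpha> i'" if "i' \<noteq> i" for i'
  proof (cases "i' < i")
    case True
    then show ?thesis
      unfolding degree_form_def by (intro sum_nonneg) (auto simp: \<alpha>_def a_nonneg)
  next
    case False
    with that have i': "i < i'" by simp
    have N0: "0 \<le> N" unfolding N_def by (intro sum_nonneg) auto
    have "{..i'} = {..i} \<union> {i<..i'}" using i' by auto
    then have "degree_form k \<alpha> i' = (\<Sum>j\<in>{..i}. int (K_num k j i') * \<alpha> $ j) + (\<Sum>j\<in>{i<..i'}. int (K_num k j i') * \<alpha> $ j)"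
      unfolding degree_form_def by (simp only:) (subst sum.union_disjoint, auto)
    moreover have "(\<Sum>j\<in>{..i}. int (K_num k j i') * \<alpha> $ j) = (\<Sum>j\<in>{..i}. int (K_num k j i') * a j)"
      by (intro sum.cong) (auto simp: \<alpha>_def)
    moreover have "\<bar>\<Sum>j\<in>{..i}. int (K_num k j i') * a j\<bar> \<le> N"
      unfolding N_def by (intro member_le_sum[of i' UNIV "\<lambda>i'. \<bar>\<Sum>j\<in>{..i}. int (K_num k j i') * a j\<bar>"]) auto
    moreover have "N \<le> (\<Sum>j\<in>{i<..i'}. int (K_num k j i') * \<alpha> $ j)"
    proof -
      have "1 * N \<le> int (K_num k i' i') * \<alpha> $ i'"
        using i' N0 K[of i' i'] by (intro mult_mono) (auto simp: \<alpha>_def)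
      also have "\<dots> \<le> (\<Sum>j\<in>{i<..i'}. int (K_num k j i') * \<alpha> $ j)"
        using i' N0 by (intro member_le_sum[of i' _ "\<lambda>j. int (K_num k j i') * \<alpha> $ j"]) (auto simp: \<alpha>_def)
      finally show ?thesis by simp
    qed
    ultimately show ?thesis by linarith
  qed
  ultimately show ?thesis by blast
qed

lemma Threshold_Omega_C:
  fixes k :: "'n::{finite,linorder} \<Rightarrow> nat"
  assumes k: "\<And>j. 0 < k j"
  shows "Threshold (Omega_C k) =
    {L_num k i / real_of_int l | (i :: 'n) (l :: int). 1 \<le> l \<and> real_of_int l \<le> L_num k i - 1}" (is "_ = ?T")
proof (intro equalityI subsetI)
  fix p assume "p \<in> Threshold (Omega_C k)"
  then have p: "1 \<le> p" and thr: "\<And>\<epsilon>. \<epsilon> > 0 \<Longrightarrow> \<exists>q\<in>{p - \<epsilon><..<p + \<epsilon>}. 1 \<le> q \<and>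
      allowable_indices q (Omega_C k) \<noteq> allowable_indices p (Omega_C k)"
    by (auto simp: Threshold_def)
  show "p \<in> ?T"
  proof (rule ccontr)
    assume notin: "p \<notin> ?T"
    have "eventually (\<lambda>q. 1 \<le> q \<longrightarrow> (\<forall>a::int. a * q > - L_num k i \<longleftrightarrow> a * p > - L_num k i)) (nhds p)" for i
    proof -
      obtain L where L: "L_num k i = real_of_int L" "0 < L"
        using L_num_int[of k i, OF k] by blast
      have "p \<noteq> L / l" if "1 \<le> l" "l \<le> L - 1" for l
      proof
        assume "p = L / l"
        then have "p = L_num k i / real_of_int l" "1 \<le> l" "real_of_int l \<le> L_num k i - 1"
          using that L by simp_all
        then have "p \<in> ?T" by (intro CollectI exI conjI)
        with notin show False by contradiction
      qed
      from eventually_int_constraint_eq[OF p L(2) this] show ?thesis by (simp add: L(1))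
    qed
    \<comment> \<open>There are finitely many \<open>i\<close>, so one neighbourhood of
      \<open>p\<close> serves all conditions and all integers at once.\<close>
    then have "eventually (\<lambda>q. \<forall>i. 1 \<le> q \<longrightarrow> (\<forall>a::int. a * q > - L_num k i \<longleftrightarrow> a * p > - L_num k i)) (nhds p)"
      by (rule eventually_all_finite)
    then obtain \<epsilon> where \<epsilon>: "\<epsilon> > 0" "\<And>q i a. dist q p < \<epsilon> \<Longrightarrow> 1 \<le> q \<Longrightarrow>
        real_of_int a * q > - L_num k i \<longleftrightarrow> real_of_int a * p > - L_num k i"
      unfolding eventually_nhds_metric by blast
    obtain q where q: "q \<in> {p - \<epsilon><..<p + \<epsilon>}" "1 \<le> q"
        "allowable_indices q (Omega_C k) \<noteq> allowable_indices p (Omega_C k)"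
      using thr[OF \<epsilon>(1)] by blast
    have "dist q p < \<epsilon>" using q(1) by (auto simp: dist_real_def)
    then have "allowable_indices q (Omega_C k) = allowable_indices p (Omega_C k)"
      using \<epsilon>(2) q(2) by (intro set_eqI) (simp add: mem_allowable_indices_iff k p)
    with q(3) show False by contradiction
  qed
next
  fix p assume "p \<in> ?T"
  then obtain i l where p_eq: "p = L_num k i / real_of_int l" and l: "1 \<le> l" "real_of_int l \<le> L_num k i - 1"
    by blast
  have lp: "real_of_int l * p = L_num k i" using l by (simp add: p_eq)
  \<comment> \<open>The bound \<open>l \<le> L_num k i - 1\<close> leaves room for exponents between
    1 and \<open>p\<close>.\<close>
  have p: "1 < p" using l by (simp add: p_eq)
  obtain \<alpha> where \<alpha>: "degree_form k \<alpha> i = - l * int (m_gcd k i)"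
      "\<And>i'. i' \<noteq> i \<Longrightarrow> 0 \<le> degree_form k \<alpha> i'"
    using degree_form_witness[of k i "- l", OF k] by blast
  have \<alpha>i: "degree_form k \<alpha> i div int (m_gcd k i) = - l"
    unfolding \<alpha>(1) using m_gcd_pos[of k i, OF k] by (intro nonzero_mult_div_cancel_right) simp
  \<comment> \<open>At \<open>p\<close> the \<open>i\<close>-th condition degenerates to an
    equality, so the strict inequality fails.\<close>
  have notin: "\<alpha> \<notin> allowable_indices p (Omega_C k)"
    unfolding mem_allowable_indices_iff[of k p \<alpha>, OF k less_imp_le[OF p]] using \<alpha>i lp
    by (auto intro!: exI[of _ i])
  have "\<exists>q\<in>{p - \<epsilon><..<p + \<epsilon>}. 1 \<le> q \<and> allowable_indices q (Omega_C k) \<noteq> allowable_indices p (Omega_C k)"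
    if "\<epsilon> > 0" for \<epsilon>
  proof -
    \<comment> \<open>A slightly smaller exponent restores the strict inequality, since the
      coefficient \<open>- l\<close> is negative; the maximum keeps it at least 1.\<close>
    define q where "q = max 1 (p - \<epsilon> / 2)"
    have q: "1 \<le> q" "q < p" "q \<in> {p - \<epsilon><..<p + \<epsilon>}"
      using that p by (auto simp: q_def)
    have "real_of_int (degree_form k \<alpha> i' div int (m_gcd k i')) * q > - L_num k i'" for i'
    proof (cases "i' = i")
      case True
      have "real_of_int l * q < real_of_int l * p" using l q by simp
      then show ?thesis using True \<alpha>i lp by simp
    next
      case False
      \<comment> \<open>The other conditions hold for every \<open>q \<ge> 1\<close>: left side
        nonnegative, right side negative.\<close>
      have "0 \<le> degree_form k \<alpha> i' div int (m_gcd k i')"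
        using \<alpha>(2)[OF False] by (intro pos_imp_zdiv_nonneg_iff[THEN iffD2]) (auto intro: m_gcd_pos k)
      moreover have "0 < L_num k i'" using L_num_int[of k i', OF k] by (metis of_int_0_less_iff)
      ultimately show ?thesis using q by (smt (verit) mult_nonneg_nonneg of_int_0_le_iff)
    qed
    then have "\<alpha> \<in> allowable_indices q (Omega_C k)"
      using q(1) by (simp add: mem_allowable_indices_iff k)
    with notin q show ?thesis by blast
  qed
  with p show "p \<in> Threshold (Omega_C k)"
    by (auto simp: Threshold_def)
qed

theorem proposition4p7:
  fixes k :: "'n::{finite,linorder} \<Rightarrow> nat"
  assumes "\<And>j. 0 < k j"
    and "Gcd (range k) = 1"
  shows "(\<forall>p\<ge>1. allowable_indices p (Omega_C k) =
        {\<alpha>. \<forall>i. (\<Sum>j\<in>{..i}. real (K_num k j i) * real_of_int (\<alpha> $ j)) * p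
                               > - 2 * (\<Sum>j\<in>{..i}. real (K_num k j i))}) \<and>
    Threshold (Omega_C k) =
      {L_num k i / real_of_int l | (i :: 'n) (l :: int). 1 \<le> l \<and> real_of_int l \<le> L_num k i - 1}"
  using allowable_indices_Omega_C[of k, OF assms(1)] Threshold_Omega_C[of k, OF assms(1)] by blast

end
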